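(* The following identity holds (as formal power series in $q$, and hence also as an identity of analytic functions for $|q|<1$): $$\sum_{n=0}^\infty \sum_{j=0}^{2n} \frac{q^{n^2}\left(\frac{n-j+1}{3}\right)}{(q;q)_{2n-j}\,(q;q)_{j}} = \frac{1}{(q^2,q^3,q^9,q^{10};q^{12})_\infty},$$ where $\left(\frac{m}{3}\right)$ denotes the Legendre symbol modulo $3$.
   Context: Notation: $(A;q)_0=1$, $(A;q)_n=(1-A)(1-Aq)\cdots(1-Aq^{n-1})$ for $n\ge 1$, $(A;q)_\infty=\prod_{i=0}^\infty(1-Aq^i)$, and $(A_1,\dots,A_r;q)_s=(A_1;q)_s\cdots(A_r;q)_s$. The Legendre symbol $\left(\frac{m}{3}\right)$ equals $1$, $-1$, $0$ according as $m\equiv 1,\,2,\,0 \pmod 3$ (for every integer $m$, including negative ones). *)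

theory Defs
  imports
    "HOL-Complex_Analysis.Complex_Analysis"
    "HOL-Computational_Algebra.Formal_Power_Series"
    "HOL-Number_Theory.Number_Theory"
begin

definition qpoch :: "'a::comm_ring_1 \<Rightarrow> 'a \<Rightarrow> nat \<Rightarrow> 'a" where
  "qpoch A q n = (\<Prod>i<n. 1 - A * q ^ i)"

(* The infinite product is taken in the topology of the type: for formal power series
   this is the q-adic topology, for complex numbers the usual one. *)
definition qpoch_inf :: "'a::{t2_space, comm_ring_1} \<Rightarrow> 'a \<Rightarrow> 'a" where
  "qpoch_inf A q = (\<Prod>i. 1 - A * q ^ i)"

definition qpoch_inf_list :: "'a::{t2_space, comm_ring_1} list \<Rightarrow> 'a \<Rightarrow> 'a" where
  "qpoch_inf_list As q = (\<Prod>A\<leftarrow>As. qpoch_inf A q)"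

end

theory Submission
  imports Defs
begin

text \<open>
  In the inner sum put \<open>j = n + k\<close>. The denominator \<open>(q; q)\<^sub>n\<^sub>-\<^sub>k (q; q)\<^sub>n\<^sub>+\<^sub>k\<close> is even in \<open>k\<close>, so only the
  even part of the coefficient \<open>((1 - k)/3)\<close> counts, and this is the even part of \<open>\<omega>^k\<close> for a
  primitive cube root of unity \<open>\<omega>\<close> (\<open>bilateral_coeff_Legendre\<close>). The left-hand side is therefore
  \<open>\<Sum>n. q^(n\<^sup>2) \<Sum>k. \<omega>^k / ((q; q)\<^sub>n\<^sub>-\<^sub>k (q; q)\<^sub>n\<^sub>+\<^sub>k)\<close>. Interchanging the sums, the sum over \<open>n\<close> is a
  generalised Durfee square identity with value \<open>q^(k\<^sup>2) / (q; q)\<^sub>\<infinity>\<close>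
  (\<open>durfee_rectangle_identity\<close>, \<open>bailey_lemma_limit\<close>). What remains is
  \<open>1 / (q; q)\<^sub>\<infinity>\<close> times the theta series \<open>\<Sum>k. \<omega>^k q^(k\<^sup>2)\<close>, which the Jacobi triple product
  (\<open>jacobi_triple_product\<close>) evaluates. Since \<open>(1 + \<omega> x) (1 + x / \<omega>) = (1 + x^3) / (1 + x)\<close>, the
  resulting product is \<open>(-q^3; q^6)\<^sub>\<infinity> / (q\<^sup>2; q^4)\<^sub>\<infinity>\<close>, and splitting it by residues modulo 12 gives
  the right-hand side (\<open>theta_quotient_eq\<close>).

  All of this is carried out for complex \<open>q\<close> with \<open>\<bar>q\<bar> < 1\<close>, where the interchanges are justified by
  a bound on \<open>1 / (q; q)\<^sub>n\<close> that is uniform in \<open>n\<close> (\<open>inverse_qpoch_bounded\<close>). The identity of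
  formal power series is then deduced from the analytic one: near \<open>0\<close> the partial sums and partial
  products converge uniformly, so their Taylor coefficients converge; each coefficient is also
  eventually constant, and hence the Taylor series converge in the \<open>X\<close>-adic topology to the
  Taylor series of the limits (\<open>fps_tendsto_of_uniform_limit\<close>).
\<close>

section \<open>The q-Pochhammer symbol\<close>

lemma qpoch_0 [simp]: "qpoch A q 0 = 1"
  by (simp add: qpoch_def)

lemma qpoch_Suc: "qpoch A q (Suc n) = qpoch A q n * (1 - A * q ^ n)"
  by (simp add: qpoch_def)

lemma qpoch_self_Suc: "qpoch q q (Suc n) = qpoch q q n * (1 - q ^ Suc n)"
  by (simp add: qpoch_def)

lemma one_minus_power_nonzero:
  fixes q :: complex
  assumes "norm q < 1" "n > 0"
  shows "1 - q ^ n \<noteq> 0"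
proof
  assume "1 - q ^ n = 0"
  hence "norm (q ^ n) = 1" by simp
  moreover have "norm (q ^ n) < 1"
    using assms by (simp add: norm_power power_less_one_iff)
  ultimately show False by simp
qed

lemma qpoch_self_nonzero:
  fixes q :: complex
  assumes "norm q < 1"
  shows "qpoch q q n \<noteq> 0"
  unfolding qpoch_def using one_minus_power_nonzero[OF assms, of "Suc _"] by simp

lemma convergent_prod_qpoch:
  fixes A q :: complex
  assumes "norm q < 1"
  shows "convergent_prod (\<lambda>i. 1 - A * q ^ i)"
proof -
  have "summable (\<lambda>i. norm A * norm q ^ i)"
    using assms by (intro summable_mult summable_geometric) auto
  hence "summable (\<lambda>i. norm ((1 - A * q ^ i) - 1))"
    by (simp add: norm_mult norm_power)
  thus ?thesis
    using abs_convergent_prod_conv_summable abs_convergent_prod_imp_convergent_prod by blast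
qed

lemma qpoch_tendsto_qpoch_inf:
  fixes A q :: complex
  assumes "norm q < 1"
  shows "qpoch A q \<longlonglongrightarrow> qpoch_inf A q"
proof -
  have "(\<lambda>n. \<Prod>i<n. 1 - A * q ^ i) \<longlonglongrightarrow> (\<Prod>i. 1 - A * q ^ i)"
    using convergent_prod_LIMSEQ[OF convergent_prod_qpoch[OF assms]] LIMSEQ_lessThan_iff_atMost
    by blast
  thus ?thesis by (simp add: qpoch_def[abs_def] qpoch_inf_def)
qed

lemma qpoch_inf_nonzero:
  fixes A q :: complex
  assumes "norm q < 1" "norm A < 1"
  shows "qpoch_inf A q \<noteq> 0"
  unfolding qpoch_inf_def
proof (rule prodinf_nonzero[OF convergent_prod_qpoch[OF assms(1)]])
  fix i
  have "norm (A * q ^ i) \<le> norm A * 1"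
    unfolding norm_mult norm_power using assms by (intro mult_left_mono power_le_one) auto
  hence "norm (A * q ^ i) < 1" using assms by simp
  thus "1 - A * q ^ i \<noteq> 0" by auto
qed

lemma qpoch_inf_eqI:
  fixes A q :: complex
  assumes "norm q < 1" "strict_mono s" "(\<lambda>n. qpoch A q (s n)) \<longlonglongrightarrow> L"
  shows "qpoch_inf A q = L"
  using LIMSEQ_subseq_LIMSEQ[OF qpoch_tendsto_qpoch_inf[OF assms(1), of A] assms(2)] assms(3)
  by (auto simp: o_def intro: LIMSEQ_unique)

text \<open>
  Factor by factor this is \<open>(1 - x) (1 + x) = 1 - x\<^sup>2\<close>.
\<close>

lemma qpoch_inf_minus_mult:
  fixes A q :: complex
  assumes "norm q < 1"
  shows "qpoch_inf A q * qpoch_inf (- A) q = qpoch_inf (A\<^sup>2) (q\<^sup>2)"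
proof -
  have q2: "norm (q\<^sup>2) < 1"
    using assms by (simp add: norm_power power_less_one_iff)
  have "qpoch A q n * qpoch (- A) q n = qpoch (A\<^sup>2) (q\<^sup>2) n" for n
    by (induction n) (auto simp: qpoch_Suc algebra_simps power2_eq_square power_mult_distrib)
  hence "(\<lambda>n. qpoch A q n * qpoch (- A) q n) \<longlonglongrightarrow> qpoch_inf (A\<^sup>2) (q\<^sup>2)"
    using qpoch_tendsto_qpoch_inf[OF q2, of "A\<^sup>2"] by simp
  moreover have "(\<lambda>n. qpoch A q n * qpoch (- A) q n) \<longlonglongrightarrow> qpoch_inf A q * qpoch_inf (- A) q"
    by (intro tendsto_mult qpoch_tendsto_qpoch_inf assms)
  ultimately show ?thesis by (rule LIMSEQ_unique[symmetric])
qed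

text \<open>
  Sorting the factors \<open>1 - A q^i\<close> by the residue of \<open>i\<close> modulo \<open>m\<close>; in the limit this turns a
  product with base \<open>q\<close> into products with base \<open>q^m\<close>, which is how the modulus 12 is reached.
\<close>

lemma qpoch_dissect:
  "qpoch A q (m * n) = (\<Prod>j<m. qpoch (A * q ^ j) (q ^ m) n)"
proof (induction n)
  case (Suc n)
  have "qpoch A q (m * Suc n) = (\<Prod>i<m * n + m. 1 - A * q ^ i)"
    by (simp add: qpoch_def add.commute)
  also have "\<dots> = qpoch A q (m * n) * (\<Prod>i\<in>{m*n..<m*n+m}. 1 - A * q ^ i)"
    unfolding qpoch_def
    by (subst prod.union_disjoint[symmetric]) (auto intro!: prod.cong)
  also have "(\<Prod>i\<in>{m*n..<m*n+m}. 1 - A * q ^ i) = (\<Prod>j<m. 1 - (A * q ^ j) * (q ^ m) ^ n)"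
    by (rule prod.reindex_bij_witness[of _ "\<lambda>j. m * n + j" "\<lambda>i. i - m * n"])
       (auto simp: power_add[symmetric] power_mult[symmetric] mult.assoc)
  finally show ?case
    by (simp add: Suc.IH qpoch_Suc prod.distrib)
qed simp

lemma qpoch_inf_dissect:
  fixes A q :: complex
  assumes "norm q < 1" "m > 0"
  shows "qpoch_inf A q = (\<Prod>j<m. qpoch_inf (A * q ^ j) (q ^ m))"
proof (rule qpoch_inf_eqI[where s = "\<lambda>n. m * n"])
  have "norm (q ^ m) < 1"
    using assms by (simp add: norm_power power_less_one_iff)
  thus "(\<lambda>n. qpoch A q (m * n)) \<longlonglongrightarrow> (\<Prod>j<m. qpoch_inf (A * q ^ j) (q ^ m))"
    unfolding qpoch_dissect by (intro tendsto_prod qpoch_tendsto_qpoch_inf)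
qed (use assms in \<open>auto simp: strict_mono_def\<close>)

lemma qpoch_inf_dissect2:
  fixes A q :: complex
  assumes "norm q < 1"
  shows "qpoch_inf A q = qpoch_inf A (q\<^sup>2) * qpoch_inf (A * q) (q\<^sup>2)"
  using qpoch_inf_dissect[OF assms, of 2 A] by (simp add: numeral_2_eq_2)

lemma qpoch_inf_dissect3:
  fixes A q :: complex
  assumes "norm q < 1"
  shows "qpoch_inf A q = qpoch_inf A (q^3) * qpoch_inf (A * q) (q^3) * qpoch_inf (A * q\<^sup>2) (q^3)"
  using qpoch_inf_dissect[OF assms, of 3 A] by (simp add: numeral_3_eq_3 numeral_2_eq_2)

text \<open>
  The dominating series for the infinite sums below rest on this bound. It holds because
  \<open>\<bar>1 - q^i\<bar> \<ge> 1 - r^i\<close>, so that \<open>\<bar>(q; q)\<^sub>n\<bar>\<close> is at least the positive infinite product \<open>(r; r)\<^sub>\<infinity>\<close>.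
  The constant depends only on \<open>r\<close>, which gives uniformity in \<open>q\<close> as well as in \<open>n\<close>.
\<close>

lemma inverse_qpoch_bounded:
  fixes r :: real
  assumes "r < 1"
  obtains C where "C > 0" "\<And>q :: complex. \<And>n. norm q \<le> r \<Longrightarrow> norm (1 / qpoch q q n) \<le> C"
proof (cases "r \<ge> 0")
  case False
  thus ?thesis using that[of 1] by (metis norm_ge_zero order_trans zero_less_one)
next
  case True
  define E where "E = (\<Prod>i. 1 - r ^ Suc i)"
  have pos: "1 - r ^ Suc i > 0" for i
    using True assms power_less_one_iff[of r "Suc i"] by (simp del: power_Suc)
  have "summable (\<lambda>i. r * r ^ i)"
    using assms True by (intro summable_mult summable_geometric) auto
  hence "summable (\<lambda>i. norm ((1 - r ^ Suc i) - 1))"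
    using True by simp
  hence conv: "convergent_prod (\<lambda>i. 1 - r ^ Suc i)"
    using abs_convergent_prod_conv_summable abs_convergent_prod_imp_convergent_prod by blast
  have lim: "(\<lambda>n. \<Prod>i\<le>n. 1 - r ^ Suc i) \<longlonglongrightarrow> E"
    unfolding E_def by (rule convergent_prod_LIMSEQ[OF conv])
  have lim: "(\<lambda>n. \<Prod>i<n. 1 - r ^ Suc i) \<longlonglongrightarrow> E"
    using lim LIMSEQ_lessThan_iff_atMost by blast
  have "E \<noteq> 0" unfolding E_def
    by (rule prodinf_nonzero[OF conv]) (use pos in \<open>auto simp: less_imp_neq[symmetric] simp del: power_Suc\<close>)
  have dec: "decseq (\<lambda>n. \<Prod>i<n. 1 - r ^ Suc i)"
  proof (rule decseq_SucI)
    fix n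
    have "(\<Prod>i<n. 1 - r ^ Suc i) * (1 - r ^ Suc n) \<le> (\<Prod>i<n. 1 - r ^ Suc i) * 1"
      using True pos by (intro mult_left_mono prod_nonneg) (auto intro: less_imp_le simp del: power_Suc)
    thus "(\<Prod>i<Suc n. 1 - r ^ Suc i) \<le> (\<Prod>i<n. 1 - r ^ Suc i)" by simp
  qed
  have Ele: "E \<le> (\<Prod>i<n. 1 - r ^ Suc i)" for n
    using decseq_ge[OF dec lim] .
  have "0 \<le> (\<Prod>i<n. 1 - r ^ Suc i)" for n
    by (intro prod_nonneg less_imp_le pos)
  hence "0 \<le> E"
    by (intro LIMSEQ_le_const[OF lim]) auto
  hence "E > 0" using \<open>E \<noteq> 0\<close> by simp
  show ?thesis
  proof (rule that[of "1 / E"])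
    fix q :: complex and n
    assume q: "norm q \<le> r"
    have "E \<le> (\<Prod>i<n. 1 - r ^ Suc i)" by (rule Ele)
    also have "\<dots> \<le> (\<Prod>i<n. norm (1 - q * q ^ i))"
    proof (rule prod_mono, safe)
      fix i
      have "norm (q ^ Suc i) \<le> r ^ Suc i"
        unfolding norm_power using q by (intro power_mono) auto
      moreover have "1 - norm (q ^ Suc i) \<le> norm (1 - q ^ Suc i)"
        using norm_triangle_ineq2[of 1 "q ^ Suc i"] by simp
      ultimately show "1 - r ^ Suc i \<le> norm (1 - q * q ^ i)" by simp
    qed (use pos in \<open>auto intro: less_imp_le simp del: power_Suc\<close>)
    also have "\<dots> = norm (qpoch q q n)"
      by (simp add: qpoch_def prod_norm)
    finally show "norm (1 / qpoch q q n) \<le> 1 / E"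
      using \<open>E > 0\<close> by (simp add: norm_divide divide_simps)
  qed (use \<open>E > 0\<close> in simp)
qed

section \<open>The Durfee rectangle identity and the Bailey lemma\<close>

text \<open>
  The right-hand side does not depend on \<open>a\<close>, and this is the key to the proof: the sums for \<open>a\<close>
  and \<open>a + 1\<close> agree because the difference of their terms telescopes, and as \<open>a\<close> tends to infinity
  only the term \<open>m = 0\<close> survives, with limit \<open>1 / (q; q)\<^sub>\<infinity>\<close>. Combinatorially, the term with
  index \<open>m\<close> counts the partitions for which \<open>m\<close> is largest such that the Ferrers diagram contains
  a rectangle of shape \<open>m \<times> (m + a)\<close>.
\<close>

lemma durfee_rectangle_identity:
  fixes q :: complex
  assumes q: "norm q < 1"
  shows "(\<lambda>m. q ^ (m\<^sup>2 + a * m) / (qpoch q q m * qpoch q q (m + a))) sums (1 / qpoch_inf q q)"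
proof -
  define d where "d = (\<lambda>a m. q ^ (m\<^sup>2 + a * m) / (qpoch q q m * qpoch q q (m + a)))"
  obtain C where C: "C > 0" "\<And>n. norm (1 / qpoch q q n) \<le> C"
    using inverse_qpoch_bounded[OF q] by (metis order_refl)
  note nz = qpoch_self_nonzero[OF q]
  have power_le: "norm (q ^ (m\<^sup>2 + a * m)) \<le> norm q ^ m" for a m
    unfolding norm_power using q
    by (intro power_decreasing) (auto simp: power2_eq_square intro: le_trans[OF le_square le_add1])
  have term_le: "norm (q ^ (m\<^sup>2 + a * m) / (qpoch q q i * qpoch q q j)) \<le> norm q ^ m * (C * C)"
    for a m i j
  proof -
    have "norm (q ^ (m\<^sup>2 + a * m) / (qpoch q q i * qpoch q q j))
          = norm (q ^ (m\<^sup>2 + a * m)) * (norm (1 / qpoch q q i) * norm (1 / qpoch q q j))"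
      by (simp add: norm_mult norm_divide)
    also have "\<dots> \<le> norm q ^ m * (C * C)"
      using C by (intro mult_mono power_le mult_nonneg_nonneg) auto
    finally show ?thesis .
  qed
  have summable_bound: "summable (\<lambda>m. norm q ^ m * (C * C))"
    using q by (intro summable_mult2 summable_geometric) auto
  have summable: "summable (d a)" for a
    by (rule summable_comparison_test'[OF summable_bound, of 0]) (unfold d_def, rule term_le)

  have step: "suminf (d a) = suminf (d (Suc a))" for a
  proof -
    \<comment> \<open>The telescoping certificate: \<open>U m\<close> is the \<open>m\<close>-th term of the sum for \<open>a\<close> times \<open>1 - q^m\<close>.\<close>
    define U where "U = (\<lambda>m. if m = 0 then 0 else
                          q ^ (m\<^sup>2 + a * m) / (qpoch q q (m - 1) * qpoch q q (m + a)))"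
    have "d a m - d (Suc a) m = U m - U (Suc m)" for m
    proof -
      define x where "x = q ^ m"
      define y where "y = q ^ a"
      define z where "z = q ^ (m\<^sup>2 + a * m)"
      define P where "P = qpoch q q (m - 1)"
      define R where "R = qpoch q q (m + a)"
      have pow: "q ^ (m\<^sup>2 + Suc a * m) = z * x" "q ^ ((Suc m)\<^sup>2 + a * Suc m) = z * x * x * q * y"
        by (simp_all add: z_def x_def y_def power_add[symmetric] power2_eq_square algebra_simps
                     flip: power_Suc)
      have R: "qpoch q q (m + Suc a) = R * (1 - q * x * y)" "qpoch q q (Suc m + a) = R * (1 - q * x * y)"
        by (simp_all add: R_def qpoch_self_Suc x_def y_def power_add mult_ac)
      have Rnz: "R \<noteq> 0" "1 - q * x * y \<noteq> 0"
        using nz[of "m + Suc a"] unfolding R by auto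
      show ?thesis
      proof (cases "m = 0")
        case True
        thus ?thesis using Rnz R pow
          by (simp add: d_def U_def) (simp add: R_def x_def y_def z_def field_simps)
      next
        case False
        hence P: "qpoch q q m = P * (1 - x)"
          using qpoch_self_Suc[of q "m - 1"] by (simp add: P_def x_def flip: power_Suc)
        have Pnz: "P \<noteq> 0" "1 - x \<noteq> 0" using nz[of m] unfolding P by auto
        have "d a m - d (Suc a) m = z / (P * (1 - x) * R) - z * x / (P * (1 - x) * (R * (1 - q * x * y)))"
          unfolding d_def pow P R by (simp add: z_def R_def)
        also have "\<dots> = z / (P * R) - z * x * x * q * y / (P * (1 - x) * (R * (1 - q * x * y)))"
          using Rnz Pnz by (simp add: divide_simps) (simp add: algebra_simps)
        also have "\<dots> = U m - U (Suc m)"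
          unfolding U_def pow R diff_Suc_1 P using False by (simp add: z_def R_def P_def)
        finally show ?thesis .
      qed
    qed
    moreover have "U \<longlonglongrightarrow> 0"
    proof (rule Lim_null_comparison)
      show "\<forall>\<^sub>F m in sequentially. norm (U m) \<le> norm q ^ m * (C * C)"
        using term_le by (intro always_eventually allI) (auto simp: U_def)
      show "(\<lambda>m. norm q ^ m * (C * C)) \<longlonglongrightarrow> 0"
        by (rule summable_LIMSEQ_zero[OF summable_bound])
    qed
    ultimately have "(\<lambda>m. d a m - d (Suc a) m) sums 0"
      using telescope_sums'[of U 0] by (simp add: U_def)
    moreover have "(\<lambda>m. d a m - d (Suc a) m) sums (suminf (d a) - suminf (d (Suc a)))"
      by (intro sums_diff summable_sums summable)
    ultimately show ?thesis using sums_unique2 by fastforce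
  qed
  hence const: "suminf (d a) = suminf (d 0)" for a
    by (induction a) auto

  have "(\<lambda>a. suminf (d a)) \<longlonglongrightarrow> (\<Sum>m. if m = 0 then 1 / qpoch_inf q q else 0)"
  proof (rule tannerys_theorem[THEN conjunct2, THEN conjunct2])
    fix m
    have "(\<lambda>a. qpoch q q (m + a)) \<longlonglongrightarrow> qpoch_inf q q"
      using LIMSEQ_ignore_initial_segment[OF qpoch_tendsto_qpoch_inf[OF q, of q], of m]
      by (simp add: add.commute)
    hence denom: "(\<lambda>a. 1 / (qpoch q q m * qpoch q q (m + a))) \<longlonglongrightarrow> 1 / (qpoch q q m * qpoch_inf q q)"
      using nz qpoch_inf_nonzero[OF q q] by (intro tendsto_intros) auto
    show "(\<lambda>a. d a m) \<longlonglongrightarrow> (if m = 0 then 1 / qpoch_inf q q else 0)"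
    proof (cases "m = 0")
      case True
      thus ?thesis using denom by (simp add: d_def)
    next
      case False
      hence "norm (q ^ m) < 1"
        using q by (simp add: norm_power power_less_one_iff)
      hence "(\<lambda>a. q ^ m\<^sup>2 * (q ^ m) ^ a * (1 / (qpoch q q m * qpoch q q (m + a))))
               \<longlonglongrightarrow> q ^ m\<^sup>2 * 0 * (1 / (qpoch q q m * qpoch_inf q q))"
        by (intro tendsto_mult denom tendsto_const LIMSEQ_power_zero)
      thus ?thesis using False
        by (simp add: d_def power_add power_mult[symmetric] mult.commute)
    qed
  next
    show "\<forall>\<^sub>F (m, a) in sequentially \<times>\<^sub>F sequentially. norm (d a m) \<le> norm q ^ m * (C * C)"
      by (rule always_eventually) (auto simp: d_def intro!: term_le)
  qed (use summable_bound in auto)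
  hence "(\<lambda>a::nat. suminf (d 0)) \<longlonglongrightarrow> (\<Sum>m. if m = 0 then 1 / qpoch_inf q q else 0)"
    by (subst (asm) const)
  moreover have "(\<Sum>m. if m = 0 then 1 / qpoch_inf q q else 0) = 1 / qpoch_inf q q"
    using sums_single[of 0 "\<lambda>_. 1 / qpoch_inf q q"] by (simp add: sums_iff eq_commute)
  ultimately have "suminf (d 0) = 1 / qpoch_inf q q"
    using LIMSEQ_unique tendsto_const by metis
  hence "d a sums (1 / qpoch_inf q q)"
    using summable_sums[OF summable, of a] const[of a] by simp
  thus ?thesis by (simp add: d_def)
qed

text \<open>
  The Bailey lemma relative to \<open>1\<close>, with both of its free parameters sent to infinity. Interchanging
  the two summations leaves, for each \<open>r\<close>, the sum over \<open>n = m + r\<close>, and since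
  \<open>(m + r)\<^sup>2 = r\<^sup>2 + (m\<^sup>2 + 2 r m)\<close> that sum is the Durfee rectangle identity with \<open>a = 2 r\<close>. Thus
  the denominators collapse into the single factor \<open>1 / (q; q)\<^sub>\<infinity>\<close>.
\<close>

lemma bailey_lemma_limit:
  fixes q :: complex and \<alpha> :: "nat \<Rightarrow> complex"
  assumes q: "norm q < 1" and \<alpha>: "\<And>r. norm (\<alpha> r) \<le> B"
  shows "(\<lambda>n. \<Sum>r\<le>n. q ^ n\<^sup>2 * \<alpha> r / (qpoch q q (n - r) * qpoch q q (n + r)))
           sums ((\<Sum>r. \<alpha> r * q ^ r\<^sup>2) / qpoch_inf q q)"
proof -
  define f where
    "f = (\<lambda>(r, m). \<alpha> r * q ^ (m + r)\<^sup>2 / (qpoch q q m * qpoch q q (m + 2 * r)))"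
  obtain C where C: "C > 0" "\<And>n. norm (1 / qpoch q q n) \<le> C"
    using inverse_qpoch_bounded[OF q] by (metis order_refl)
  have B: "B \<ge> 0" using order_trans[OF norm_ge_zero \<alpha>] .
  have geometric: "(\<lambda>n. norm q ^ n) summable_on UNIV"
    using q by (intro summable_nonneg_imp_summable_on summable_geometric) auto

  have "(\<lambda>x. norm ((\<lambda>(r, m). norm q ^ r * norm q ^ m) x)) summable_on (UNIV \<times> UNIV)"
    by (rule Infinite_Sum.abs_summable_on_Sigma_iff[THEN iffD2])
       (auto simp: abs_mult infsum_cmult_right' intro!: geometric summable_on_cmult_right summable_on_cmult_left)
  hence "(\<lambda>(r, m). norm q ^ r * norm q ^ m) summable_on (UNIV \<times> UNIV)"
    by (rule abs_summable_summable)
  hence "(\<lambda>x. (B * (C * C)) * (\<lambda>(r, m). norm q ^ r * norm q ^ m) x) summable_on (UNIV \<times> UNIV)"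
    by (rule summable_on_cmult_right)
  hence f_summable: "(\<lambda>x. norm (f x)) summable_on (UNIV \<times> UNIV)"
  proof (rule summable_on_comparison_test)
    fix x :: "nat \<times> nat"
    obtain r m where x: "x = (r, m)" by (cases x)
    have "norm (q ^ (m + r)\<^sup>2) \<le> norm q ^ (r + m)"
      unfolding norm_power using q le_square[of "m + r"]
      by (intro power_decreasing) (auto simp: power2_eq_square add.commute)
    hence "norm (\<alpha> r) * norm (q ^ (m + r)\<^sup>2) * (norm (1 / qpoch q q m) * norm (1 / qpoch q q (m + 2 * r)))
          \<le> B * norm q ^ (r + m) * (C * C)"
      using C B by (intro mult_mono \<alpha> mult_nonneg_nonneg) auto
    thus "norm (f x) \<le> B * (C * C) * (\<lambda>(r, m). norm q ^ r * norm q ^ m) x"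
      by (simp add: x f_def norm_mult norm_divide power_add mult_ac)
  qed simp
  then obtain S where S: "(f has_sum S) (UNIV \<times> UNIV)"
    using abs_summable_summable summable_iff_has_sum_infsum by blast

  have row: "((\<lambda>m. f (r, m)) has_sum (\<alpha> r * q ^ r\<^sup>2 / qpoch_inf q q)) UNIV" for r
  proof (rule norm_summable_imp_has_sum)
    have "(\<lambda>m. norm (f (r, m))) summable_on UNIV"
      using f_summable by (subst (asm) Infinite_Sum.abs_summable_on_Sigma_iff) auto
    thus "summable (\<lambda>m. norm (f (r, m)))"
      by (rule summable_on_imp_summable)
    have "(m + r)\<^sup>2 = r\<^sup>2 + (m\<^sup>2 + 2 * r * m)" for m
      by (simp add: power2_eq_square algebra_simps)
    hence "f (r, m) = (\<alpha> r * q ^ r\<^sup>2) * (q ^ (m\<^sup>2 + 2 * r * m) / (qpoch q q m * qpoch q q (m + 2 * r)))" for m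
      by (simp add: f_def power_add)
    thus "(\<lambda>m. f (r, m)) sums (\<alpha> r * q ^ r\<^sup>2 / qpoch_inf q q)"
      using sums_mult[OF durfee_rectangle_identity[OF q, of "2 * r"], of "\<alpha> r * q ^ r\<^sup>2"] by simp
  qed
  have "((\<lambda>r. \<alpha> r * q ^ r\<^sup>2 / qpoch_inf q q) has_sum S) UNIV"
    using S row by (rule has_sum_SigmaD)
  hence "(\<lambda>r. \<alpha> r * q ^ r\<^sup>2 / qpoch_inf q q) sums S"
    by (rule has_sum_imp_sums)
  hence "(\<lambda>r. \<alpha> r * q ^ r\<^sup>2) sums (S * qpoch_inf q q)"
    using sums_mult2[of _ S "qpoch_inf q q"] qpoch_inf_nonzero[OF q q] by fastforce
  hence S_eq: "S = (\<Sum>r. \<alpha> r * q ^ r\<^sup>2) / qpoch_inf q q"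
    using qpoch_inf_nonzero[OF q q] by (simp add: sums_iff)

  \<comment> \<open>The same family summed along the diagonals \<open>n = m + r\<close>.\<close>
  define g where "g = (\<lambda>(n, r). q ^ n\<^sup>2 * \<alpha> r / (qpoch q q (n - r) * qpoch q q (n + r)))"
  have "(g has_sum S) (Sigma UNIV (\<lambda>n. {..n})) \<longleftrightarrow> (f has_sum S) (UNIV \<times> UNIV)"
    by (rule has_sum_reindex_bij_witness[of _ "\<lambda>(r, m). (m + r, r)" "\<lambda>(n, r). (r, n - r)"])
       (auto simp: f_def g_def mult_2 mult.commute add.commute add.left_commute)
  hence "(g has_sum S) (Sigma UNIV (\<lambda>n. {..n}))" using S by simp
  hence "((\<lambda>n. \<Sum>r\<le>n. g (n, r)) has_sum S) UNIV"
    by (rule has_sum_SigmaD) (auto intro: has_sum_finite)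
  thus ?thesis
    using has_sum_imp_sums S_eq by (simp add: g_def)
qed

section \<open>The Jacobi triple product\<close>

text \<open>
  The convention \<open>1 / (p; p)\<^sub>i = 0\<close> for \<open>i < 0\<close> makes bilateral sums finite and lets their index be
  shifted freely; the first-order recurrence then holds for all integers.
\<close>

definition inv_qpoch :: "complex \<Rightarrow> int \<Rightarrow> complex" where
  "inv_qpoch p i = (if i < 0 then 0 else 1 / qpoch p p (nat i))"

lemma inv_qpoch_of_nat: "inv_qpoch p (int n) = 1 / qpoch p p n"
  by (simp add: inv_qpoch_def)

lemma inv_qpoch_pred:
  assumes "norm p < 1"
  shows "inv_qpoch p (i - 1) = (1 - p powi i) * inv_qpoch p i"
proof (cases "i > 0")
  case True
  then obtain n where n: "i = int (Suc n)"
    by (metis gr0_implies_Suc pos_int_cases)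
  have "qpoch p p (Suc n) \<noteq> 0" by (rule qpoch_self_nonzero[OF assms])
  moreover have "inv_qpoch p (i - 1) = 1 / qpoch p p n"
    unfolding n by (simp add: inv_qpoch_def)
  ultimately show ?thesis
    unfolding n inv_qpoch_of_nat power_int_of_nat by (simp add: qpoch_self_Suc)
next
  case False
  thus ?thesis by (cases "i = 0") (auto simp: inv_qpoch_def)
qed

lemma sum_int_shift:
  fixes f :: "int \<Rightarrow> 'a :: comm_monoid_add"
  assumes "\<And>k. \<bar>k\<bar> > N \<Longrightarrow> f k = 0" "N + \<bar>s\<bar> \<le> M"
  shows "(\<Sum>k=-M..M. f (k + s)) = (\<Sum>k=-N..N. f k)"
proof -
  have "(\<Sum>k=-M..M. f (k + s)) = (\<Sum>k=-M+s..M+s. f k)"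
    by (rule sum.reindex_bij_witness[of _ "\<lambda>k. k - s" "\<lambda>k. k + s"]) auto
  also have "\<dots> = (\<Sum>k=-N..N. f k)"
    by (rule sum.mono_neutral_right) (use assms in auto)
  finally show ?thesis .
qed

text \<open>
  By induction on \<open>n\<close>. Passing from \<open>n\<close> to \<open>n + 1\<close> multiplies the right-hand side by
  \<open>1 + Q\<^sup>2 + Q z + Q / z\<close> with \<open>Q = q ^ (2 n + 1)\<close>, and multiplication by \<open>z\<close> and by \<open>1 / z\<close> shifts
  the summation index by one. Comparing coefficients of \<open>z^k\<close> leaves a three-term relation between
  \<open>q\<close>-binomial coefficients: with \<open>x = p^(n+1-k)\<close> and \<open>y = p^(n+1+k)\<close> it becomes
  \<open>(1 - xy/p) (1 - xy) = (1 + xy/p) (1 - x) (1 - y) + x (1 - y/p) (1 - y) + y (1 - x/p) (1 - x)\<close>.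
\<close>

lemma finite_jacobi_triple_product:
  fixes q z :: complex
  assumes q: "norm q < 1" "q \<noteq> 0" and z: "z \<noteq> 0"
  shows "qpoch (q\<^sup>2) (q\<^sup>2) (2 * n) *
           (\<Sum>k=-int n..int n. z powi k * q powi k\<^sup>2 *
              (inv_qpoch (q\<^sup>2) (int n - k) * inv_qpoch (q\<^sup>2) (int n + k)))
         = (\<Prod>i<n. (1 + z * q ^ (2 * i + 1)) * (1 + q ^ (2 * i + 1) / z))"
proof (induction n)
  case 0
  show ?case by (simp add: inv_qpoch_def)
next
  case (Suc n)
  define p where "p = q\<^sup>2"
  have p: "norm p < 1" "p \<noteq> 0"
    using q by (auto simp: p_def norm_power power_less_one_iff)
  define g where "g = (\<lambda>n k. z powi k * q powi k\<^sup>2 * (inv_qpoch p (int n - k) * inv_qpoch p (int n + k)))"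
  define N where "N = int (Suc n)"
  define Q where "Q = q ^ (2 * n + 1)"
  have supp: "g n k = 0" if "\<bar>k\<bar> > int n" for k
    using that by (auto simp: g_def inv_qpoch_def)
  have p_powi: "p powi k = q powi (2 * k)" for k
    by (simp add: p_def power_int_mult)
  have Q_powi: "Q = q powi (2 * N - 1)"
    unfolding Q_def N_def using power_int_of_nat[of q "2 * n + 1"] by (simp add: algebra_simps)

  have "(1 - p ^ (2 * n + 1)) * (1 - p ^ (2 * n + 2)) * g (Suc n) k
        = (1 + Q\<^sup>2) * g n k + Q * (z * g n (k - 1)) + Q * (g n (k + 1) / z)" for k
  proof -
    define i where "i = N - k"
    define j where "j = N + k"
    define x where "x = p powi i"
    define y where "y = p powi j"
    define u where "u = z powi k * q powi k\<^sup>2"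
    define R where "R = inv_qpoch p i * inv_qpoch p j"
    have i1: "inv_qpoch p (i - 1) = (1 - x) * inv_qpoch p i"
      using inv_qpoch_pred[OF p(1)] by (simp add: x_def)
    have i2: "inv_qpoch p (i - 2) = (1 - x / p) * (1 - x) * inv_qpoch p i"
      using inv_qpoch_pred[OF p(1), of "i - 1"] i1 p by (simp add: x_def power_int_diff)
    have j1: "inv_qpoch p (j - 1) = (1 - y) * inv_qpoch p j"
      using inv_qpoch_pred[OF p(1)] by (simp add: y_def)
    have j2: "inv_qpoch p (j - 2) = (1 - y / p) * (1 - y) * inv_qpoch p j"
      using inv_qpoch_pred[OF p(1), of "j - 1"] j1 p by (simp add: y_def power_int_diff)

    have xy: "x * y = p ^ (2 * n + 2)"
    proof -
      have "x * y = p powi (i + j)" using p by (simp add: x_def y_def power_int_add)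
      also have "i + j = int (2 * n + 2)" by (simp add: i_def j_def N_def)
      finally show ?thesis by (simp only: power_int_of_nat)
    qed
    hence xyp: "x * y / p = p ^ (2 * n + 1)" using p by simp
    have Q2: "Q\<^sup>2 = x * y / p"
      unfolding xyp by (simp only: p_def Q_def power_mult[symmetric] mult.commute)

    have g0: "g (Suc n) k = u * R"
      by (simp add: g_def u_def R_def i_def j_def N_def)
    have g1: "g n k = u * ((1 - x) * (1 - y) * R)"
    proof -
      have "int n - k = i - 1" "int n + k = j - 1" by (simp_all add: i_def j_def N_def)
      thus ?thesis unfolding g_def i1 j1 by (simp add: i1 j1 u_def R_def mult_ac)
    qed
    have g2: "Q * (z * g n (k - 1)) = u * (x * (1 - y / p) * (1 - y) * R)"
    proof -
      have k: "int n - (k - 1) = i" "int n + (k - 1) = j - 2"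
        by (simp_all add: i_def j_def N_def)
      have zk: "z * z powi (k - 1) = z powi k"
        using z by (simp add: power_int_diff)
      have qk: "Q * q powi (k - 1)\<^sup>2 = q powi k\<^sup>2 * x"
        unfolding Q_powi x_def p_powi i_def using q
        by (simp add: power_int_add[symmetric] power2_eq_square algebra_simps)
      have "Q * (z * g n (k - 1)) = (z * z powi (k - 1)) * (Q * q powi (k - 1)\<^sup>2) *
              (inv_qpoch p (int n - (k - 1)) * inv_qpoch p (int n + (k - 1)))"
        unfolding g_def by (simp only: mult_ac)
      thus ?thesis
        unfolding k zk qk j2 u_def R_def by (simp only: mult_ac)
    qed
    have g3: "Q * (g n (k + 1) / z) = u * (y * (1 - x / p) * (1 - x) * R)"
    proof -
      have k: "int n - (k + 1) = i - 2" "int n + (k + 1) = j"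
        by (simp_all add: i_def j_def N_def)
      have zk: "z powi (k + 1) / z = z powi k"
        using z by (simp add: power_int_add)
      have qk: "Q * q powi (k + 1)\<^sup>2 = q powi k\<^sup>2 * y"
        unfolding Q_powi y_def p_powi j_def using q
        by (simp add: power_int_add[symmetric] power2_eq_square algebra_simps)
      have "Q * (g n (k + 1) / z) = (z powi (k + 1) / z) * (Q * q powi (k + 1)\<^sup>2) *
              (inv_qpoch p (int n - (k + 1)) * inv_qpoch p (int n + (k + 1)))"
        unfolding g_def by (simp only: mult_ac times_divide_eq_right times_divide_eq_left)
      thus ?thesis
        unfolding k zk qk i2 u_def R_def by (simp only: mult_ac)
    qed
    show ?thesis
      unfolding g0 g1 g2 g3 Q2 xy[symmetric] xyp[symmetric] using p
      by (simp add: field_simps)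
  qed
  hence "(1 - p ^ (2 * n + 1)) * (1 - p ^ (2 * n + 2)) * (\<Sum>k=-N..N. g (Suc n) k)
         = (1 + Q\<^sup>2) * (\<Sum>k=-N..N. g n k) + Q * (z * (\<Sum>k=-N..N. g n (k - 1)))
             + Q * ((\<Sum>k=-N..N. g n (k + 1)) / z)"
    by (simp only: sum_distrib_left sum_divide_distrib sum.distrib)
  moreover have "(\<Sum>k=-N..N. g n (k + s)) = (\<Sum>k=-int n..int n. g n k)" if "\<bar>s\<bar> \<le> 1" for s
    by (rule sum_int_shift) (use supp that in \<open>auto simp: N_def\<close>)
  from this[of 0] this[of 1] this[of "-1"]
  have "(\<Sum>k=-N..N. g n k) = (\<Sum>k=-int n..int n. g n k)"
       "(\<Sum>k=-N..N. g n (k + 1)) = (\<Sum>k=-int n..int n. g n k)"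
       "(\<Sum>k=-N..N. g n (k - 1)) = (\<Sum>k=-int n..int n. g n k)"
    by simp_all
  moreover have "(1 + Q\<^sup>2) * S + Q * (z * S) + Q * (S / z) = (1 + z * Q) * (1 + Q / z) * S" for S
    using z by (simp add: field_simps power2_eq_square)
  ultimately have "(1 - p ^ (2 * n + 1)) * (1 - p ^ (2 * n + 2)) * (\<Sum>k=-N..N. g (Suc n) k)
         = (1 + z * Q) * (1 + Q / z) * (\<Sum>k=-int n..int n. g n k)"
    by (simp only:)
  moreover have "qpoch p p (2 * Suc n) = qpoch p p (2 * n) * ((1 - p ^ (2 * n + 1)) * (1 - p ^ (2 * n + 2)))"
    by (simp add: qpoch_self_Suc mult_ac)
  ultimately have "qpoch p p (2 * Suc n) * (\<Sum>k=-N..N. g (Suc n) k)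
         = (1 + z * Q) * (1 + Q / z) * (qpoch p p (2 * n) * (\<Sum>k=-int n..int n. g n k))"
    by (simp only: mult_ac)
  thus ?case
    using Suc.IH by (simp add: g_def N_def Q_def p_def mult_ac)
qed

text \<open>
  The coefficient of \<open>f r\<close> after folding a bilateral sum of \<open>c k * f k\<close> with \<open>f\<close> even. The
  one-sided form fits the limit theorems for series indexed by natural numbers, and it also shows
  that only the even part of \<open>c\<close> matters.
\<close>

definition bilateral_coeff :: "(int \<Rightarrow> complex) \<Rightarrow> nat \<Rightarrow> complex" where
  "bilateral_coeff c r = (if r = 0 then c 0 else c (int r) + c (- int r))"

lemma norm_bilateral_coeff_le:
  assumes "norm z = 1"
  shows "norm (bilateral_coeff ((powi) z) r) \<le> 2"
proof -
  have "norm (z powi int r) = 1" "norm (z powi (- int r)) = 1"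
    using assms by (simp_all only: norm_power_int power_int_1_left)
  thus ?thesis
    using norm_triangle_ineq[of "z powi int r" "z powi (- int r)"]
    unfolding bilateral_coeff_def by (cases "r = 0") simp_all
qed

lemma sum_bilateral_fold:
  fixes f c :: "int \<Rightarrow> complex"
  assumes "\<And>k. f (- k) = f k"
  shows "(\<Sum>k=-int n..int n. c k * f k) = (\<Sum>r\<le>n. bilateral_coeff c r * f (int r))"
proof (induction n)
  case (Suc n)
  have "{-int (Suc n)..int (Suc n)} = insert (int (Suc n)) (insert (- int (Suc n)) {-int n..int n})"
    by auto
  hence "(\<Sum>k=-int (Suc n)..int (Suc n). c k * f k) =
          c (int (Suc n)) * f (int (Suc n)) + (c (- int (Suc n)) * f (- int (Suc n)) +
          (\<Sum>k=-int n..int n. c k * f k))"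
    by (simp del: of_nat_Suc)
  thus ?case
    unfolding Suc.IH assms by (simp add: bilateral_coeff_def algebra_simps)
qed (simp add: bilateral_coeff_def)

text \<open>
  Tannery's theorem applied to the finite triple product, the dominating series being
  \<open>2 C\<^sup>2 \<bar>q\<bar>^r\<close>. On both sides the \<open>q\<close>-factorials tend to \<open>(q\<^sup>2; q\<^sup>2)\<^sub>\<infinity>\<close>, twice in the
  denominator of the sum and once in that of the product. Requiring \<open>\<bar>z\<bar> = 1\<close> keeps the
  coefficients bounded by 2.
\<close>

lemma jacobi_triple_product:
  fixes q z :: complex
  assumes q: "norm q < 1" "q \<noteq> 0" and z: "norm z = 1"
  shows "(\<Sum>r. bilateral_coeff ((powi) z) r * q ^ r\<^sup>2) =
           qpoch_inf (q\<^sup>2) (q\<^sup>2) * qpoch_inf (- z * q) (q\<^sup>2) * qpoch_inf (- q / z) (q\<^sup>2)"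
proof -
  define p where "p = q\<^sup>2"
  have p: "norm p < 1"
    using q by (simp add: p_def norm_power power_less_one_iff)
  define P where "P = qpoch_inf p p"
  have P: "P \<noteq> 0" unfolding P_def by (rule qpoch_inf_nonzero[OF p p])
  have z0: "z \<noteq> 0" using z by auto
  define a where "a = (\<lambda>r n. if r \<le> n then bilateral_coeff ((powi) z) r * q ^ r\<^sup>2 *
                          (1 / qpoch p p (n - r) * (1 / qpoch p p (n + r))) else 0)"
  obtain C where C: "C > 0" "\<And>n. norm (1 / qpoch p p n) \<le> C"
    using inverse_qpoch_bounded[OF p] by (metis order_refl)
  have lim: "(\<lambda>n. qpoch p p (n + m)) \<longlonglongrightarrow> P" for m
    unfolding P_def by (rule LIMSEQ_ignore_initial_segment[OF qpoch_tendsto_qpoch_inf[OF p]])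
  have lim': "(\<lambda>n. qpoch p p (n - m)) \<longlonglongrightarrow> P" for m
    unfolding P_def by (rule LIMSEQ_offset[where k = m]) (simp add: qpoch_tendsto_qpoch_inf[OF p])
  have "(\<lambda>n. \<Sum>r. a r n) \<longlonglongrightarrow> (\<Sum>r. bilateral_coeff ((powi) z) r * q ^ r\<^sup>2 * (1 / P * (1 / P)))"
  proof (rule tannerys_theorem[THEN conjunct2, THEN conjunct2])
    fix r
    have "(\<lambda>n. bilateral_coeff ((powi) z) r * q ^ r\<^sup>2 * (1 / qpoch p p (n - r) * (1 / qpoch p p (n + r))))
            \<longlonglongrightarrow> bilateral_coeff ((powi) z) r * q ^ r\<^sup>2 * (1 / P * (1 / P))"
      by (intro tendsto_mult tendsto_const tendsto_divide lim lim' P)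
    moreover have "\<forall>\<^sub>F n in sequentially. a r n =
        bilateral_coeff ((powi) z) r * q ^ r\<^sup>2 * (1 / qpoch p p (n - r) * (1 / qpoch p p (n + r)))"
      using eventually_ge_at_top[of r] by eventually_elim (simp add: a_def)
    ultimately show "a r \<longlonglongrightarrow> bilateral_coeff ((powi) z) r * q ^ r\<^sup>2 * (1 / P * (1 / P))"
      by (rule Lim_transform_eventually[OF _ eventually_mono]) simp
  next
    have "norm (a r n) \<le> 2 * norm q ^ r * (C * C)" for r n
    proof (cases "r \<le> n")
      case True
      have "norm (q ^ r\<^sup>2) \<le> norm q ^ r"
        unfolding norm_power using q by (intro power_decreasing) (auto simp: power2_eq_square)
      hence "norm (bilateral_coeff ((powi) z) r) * norm (q ^ r\<^sup>2) *
              (norm (1 / qpoch p p (n - r)) * norm (1 / qpoch p p (n + r))) \<le> 2 * norm q ^ r * (C * C)"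
        using C z by (intro mult_mono norm_bilateral_coeff_le mult_nonneg_nonneg) auto
      thus ?thesis using True by (simp add: a_def norm_mult norm_divide)
    qed (use C in \<open>simp add: a_def\<close>)
    thus "\<forall>\<^sub>F (r, n) in sequentially \<times>\<^sub>F sequentially. norm (a r n) \<le> 2 * norm q ^ r * (C * C)"
      by (intro always_eventually) auto
    show "summable (\<lambda>r. 2 * norm q ^ r * (C * C))"
      using q by (intro summable_mult2 summable_mult summable_geometric) auto
  qed auto
  moreover have "(\<Sum>r. a r n) = 1 / qpoch p p (2 * n) * (qpoch (- z * q) p n * qpoch (- q / z) p n)" for n
  proof -
    define h where "h = (\<lambda>k. q powi k\<^sup>2 * (inv_qpoch p (int n - k) * inv_qpoch p (int n + k)))"
    have "(\<Sum>r. a r n) = (\<Sum>r\<le>n. a r n)"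
      by (rule suminf_finite) (auto simp: a_def)
    also have "\<dots> = (\<Sum>r\<le>n. bilateral_coeff ((powi) z) r * h (int r))"
    proof (rule sum.cong)
      fix r assume "r \<in> {..n}"
      moreover have "q powi (int r)\<^sup>2 = q ^ r\<^sup>2"
        using power_int_of_nat[of q "r\<^sup>2"] by simp
      ultimately show "a r n = bilateral_coeff ((powi) z) r * h (int r)"
        using inv_qpoch_of_nat[of p "n - r"] inv_qpoch_of_nat[of p "n + r"]
        by (simp add: a_def h_def of_nat_diff)
    qed simp
    also have "\<dots> = (\<Sum>k=-int n..int n. z powi k * h k)"
      by (rule sum_bilateral_fold[symmetric]) (simp add: h_def mult.commute)
    finally have "qpoch p p (2 * n) * (\<Sum>r. a r n) =
        (\<Prod>i<n. (1 + z * q ^ (2 * i + 1)) * (1 + q ^ (2 * i + 1) / z))"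
      using finite_jacobi_triple_product[OF q z0, of n] by (simp add: h_def p_def mult.assoc)
    also have "\<dots> = qpoch (- z * q) p n * qpoch (- q / z) p n"
    proof -
      have eq: "q ^ (2 * i + 1) = q * p ^ i" for i
        unfolding p_def power_add power_mult by simp
      thus ?thesis
        unfolding qpoch_def prod.distrib[symmetric] eq by (simp add: mult.assoc)
    qed
    finally show ?thesis
      using qpoch_self_nonzero[OF p, of "2 * n"] by (simp add: field_simps)
  qed
  moreover have "(\<lambda>n. 1 / qpoch p p (2 * n) * (qpoch (- z * q) p n * qpoch (- q / z) p n))
      \<longlonglongrightarrow> 1 / P * (qpoch_inf (- z * q) p * qpoch_inf (- q / z) p)"
  proof (intro tendsto_mult tendsto_const tendsto_divide qpoch_tendsto_qpoch_inf p P)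
    show "(\<lambda>n. qpoch p p (2 * n)) \<longlonglongrightarrow> P"
      using LIMSEQ_subseq_LIMSEQ[OF qpoch_tendsto_qpoch_inf[OF p, of p], of "\<lambda>n. 2 * n"]
      by (simp add: P_def o_def strict_mono_def)
  qed
  ultimately have "(\<Sum>r. bilateral_coeff ((powi) z) r * q ^ r\<^sup>2 * (1 / P * (1 / P)))
      = 1 / P * (qpoch_inf (- z * q) p * qpoch_inf (- q / z) p)"
    by (simp only: LIMSEQ_unique)
  moreover have "(\<Sum>r. bilateral_coeff ((powi) z) r * q ^ r\<^sup>2 * (1 / P * (1 / P)))
      = (\<Sum>r. bilateral_coeff ((powi) z) r * q ^ r\<^sup>2) * (1 / P * (1 / P))"
  proof (rule suminf_mult2[symmetric], rule summable_comparison_test'[of "\<lambda>r. 2 * norm q ^ r" 0])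
    show "summable (\<lambda>r. 2 * norm q ^ r)"
      using q by (intro summable_mult summable_geometric) auto
    fix r
    have "norm (q ^ r\<^sup>2) \<le> norm q ^ r"
      unfolding norm_power using q by (intro power_decreasing) (auto simp: power2_eq_square)
    thus "norm (bilateral_coeff ((powi) z) r * q ^ r\<^sup>2) \<le> 2 * norm q ^ r"
      unfolding norm_mult using z by (intro mult_mono norm_bilateral_coeff_le) auto
  qed
  ultimately show ?thesis
    using P by (simp add: field_simps p_def P_def)
qed

section \<open>The identity for complex arguments\<close>

lemma Legendre_3:
  "Legendre m 3 = (if m mod 3 = 0 then 0 else if m mod 3 = 1 then 1 else -1)"
proof -
  have "QuadRes 3 m \<longleftrightarrow> m mod 3 = 0 \<or> m mod 3 = 1"
  proof
    assume "QuadRes 3 m"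
    then obtain y where y: "y\<^sup>2 mod 3 = m mod 3"
      by (auto simp: QuadRes_def cong_def)
    have "y mod 3 = 0 \<or> y mod 3 = 1 \<or> y mod 3 = 2" by presburger
    hence "(y mod 3)\<^sup>2 mod 3 = 0 \<or> (y mod 3)\<^sup>2 mod 3 = 1" by auto
    thus "m mod 3 = 0 \<or> m mod 3 = 1" using y by (simp add: power_mod)
  next
    assume "m mod 3 = 0 \<or> m mod 3 = 1"
    hence "[0\<^sup>2 = m] (mod 3) \<or> [1\<^sup>2 = m] (mod 3)" by (auto simp: cong_def)
    thus "QuadRes 3 m" unfolding QuadRes_def by blast
  qed
  thus ?thesis by (auto simp: Legendre_def cong_def)
qed

lemma primitive_cube_root_of_unity:
  obtains \<omega> :: complex where "norm \<omega> = 1" "\<omega>\<^sup>2 + \<omega> + 1 = 0"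
proof
  show "norm (Complex (-1/2) (sqrt 3 / 2)) = 1"
    by (simp add: cmod_def power_divide)
  show "(Complex (-1/2) (sqrt 3 / 2))\<^sup>2 + Complex (-1/2) (sqrt 3 / 2) + 1 = 0"
    by (simp add: complex_eq_iff power2_eq_square)
qed

text \<open>
  This is where the Legendre symbol enters: \<open>((1 - k)/3)\<close> and \<open>\<omega>^k\<close> have the same even part, so
  they are interchangeable in a symmetric sum. Both symmetrised coefficients are \<open>2\<close> when \<open>3\<close>
  divides \<open>r > 0\<close>, and \<open>-1\<close> when it does not.
\<close>

lemma bilateral_coeff_Legendre:
  fixes \<omega> :: complex
  assumes \<omega>: "\<omega>\<^sup>2 + \<omega> + 1 = 0"
  shows "bilateral_coeff (\<lambda>k. of_int (Legendre (1 - k) 3)) r = bilateral_coeff ((powi) \<omega>) r"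
proof (cases "r = 0")
  case False
  have "\<omega>\<^sup>2 = (\<omega>\<^sup>2 + \<omega> + 1) - \<omega> - 1" by simp
  hence sq: "\<omega>\<^sup>2 = - \<omega> - 1" unfolding \<omega> by simp
  have "\<omega> ^ 3 - 1 = (\<omega> - 1) * (\<omega>\<^sup>2 + \<omega> + 1)"
    by (simp add: algebra_simps power2_eq_square power3_eq_cube)
  hence cube: "\<omega> ^ 3 = 1" using \<omega> by simp
  have "\<omega> * \<omega>\<^sup>2 = 1" using cube by (simp add: power3_eq_cube power2_eq_square mult.assoc)
  hence inv: "inverse \<omega> = \<omega>\<^sup>2" by (metis inverse_unique)
  have red: "x ^ r = x ^ (r mod 3)" if "x ^ 3 = 1" for x :: complex
  proof -
    have "x ^ r = x ^ (3 * (r div 3) + r mod 3)" by simp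
    also have "\<dots> = x ^ (r mod 3)" by (simp only: power_add power_mult that power_one mult_1)
    finally show ?thesis .
  qed
  have "(\<omega>\<^sup>2) ^ 3 = (\<omega> ^ 3)\<^sup>2" by (simp flip: power_mult)
  hence cube2: "(\<omega>\<^sup>2) ^ 3 = 1" by (simp add: cube)
  have "(\<omega>\<^sup>2)\<^sup>2 = \<omega> ^ 3 * \<omega>"
    by (simp add: power2_eq_square power3_eq_cube mult.assoc)
  hence fourth: "(\<omega>\<^sup>2)\<^sup>2 = \<omega>" by (simp add: cube)
  have "\<omega> powi int r + \<omega> powi (- int r) = \<omega> ^ (r mod 3) + (\<omega>\<^sup>2) ^ (r mod 3)"
  proof -
    have "\<omega> powi (- int r) = inverse (\<omega> ^ r)"
      by (simp only: power_int_minus power_int_of_nat)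
    also have "\<dots> = (\<omega>\<^sup>2) ^ r"
      by (simp only: power_inverse[symmetric] inv)
    finally show ?thesis
      by (simp only: power_int_of_nat red[OF cube] red[OF cube2])
  qed
  moreover have "r mod 3 = 0 \<or> r mod 3 = 1 \<or> r mod 3 = 2" by presburger
  moreover have "Legendre (1 - int r) 3 + Legendre (1 + int r) 3 = (if r mod 3 = 0 then 2 else -1)"
  proof -
    have "int r mod 3 = 0 \<or> int r mod 3 = 1 \<or> int r mod 3 = 2" by presburger
    then consider "int r mod 3 = 0" | "int r mod 3 = 1" | "int r mod 3 = 2" by blast
    thus ?thesis
    proof cases
      case 1
      hence "(1 - int r) mod 3 = 1" "(1 + int r) mod 3 = 1" "r mod 3 = 0" by presburger+
      thus ?thesis by (simp add: Legendre_3)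
    next
      case 2
      hence "(1 - int r) mod 3 = 0" "(1 + int r) mod 3 = 2" "r mod 3 \<noteq> 0" by presburger+
      thus ?thesis by (simp add: Legendre_3)
    next
      case 3
      hence "(1 - int r) mod 3 = 2" "(1 + int r) mod 3 = 0" "r mod 3 \<noteq> 0" by presburger+
      thus ?thesis by (simp add: Legendre_3)
    qed
  qed
  hence "(of_int (Legendre (1 - int r) 3) + of_int (Legendre (1 + int r) 3) :: complex) =
           (if r mod 3 = 0 then 2 else -1)"
    by (metis of_int_add of_int_minus of_int_1 of_int_numeral)
  moreover have "\<omega> + \<omega>\<^sup>2 = -1" "\<omega>\<^sup>2 + (\<omega>\<^sup>2)\<^sup>2 = -1"
    by (simp_all only: fourth) (simp_all add: sq)
  ultimately show ?thesis
    using False by (auto simp: bilateral_coeff_def)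
qed (simp add: bilateral_coeff_def Legendre_3)

definition legendre_term :: "'a::{comm_ring_1, inverse} \<Rightarrow> nat \<Rightarrow> 'a" where
  "legendre_term q n = (\<Sum>j=0..2*n. q ^ n\<^sup>2 * of_int (Legendre (int n - int j + 1) 3)
                          / (qpoch q q (2 * n - j) * qpoch q q j))"

text \<open>
  With \<open>j = n + k\<close> the denominators become symmetric in \<open>k\<close>, so the Legendre symbol may be
  replaced by powers of \<open>\<omega>\<close>.
\<close>

lemma legendre_term_eq:
  fixes q \<omega> :: complex
  assumes \<omega>: "\<omega>\<^sup>2 + \<omega> + 1 = 0"
  shows "legendre_term q n
         = (\<Sum>r\<le>n. q ^ n\<^sup>2 * bilateral_coeff ((powi) \<omega>) r / (qpoch q q (n - r) * qpoch q q (n + r)))"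
proof -
  define h where "h = (\<lambda>k. q ^ n\<^sup>2 * (inv_qpoch q (int n - k) * inv_qpoch q (int n + k)))"
  have "legendre_term q n = (\<Sum>k=-int n..int n. of_int (Legendre (1 - k) 3) * h k)"
    unfolding legendre_term_def
  proof (rule sum.reindex_bij_witness[of _ "\<lambda>k. nat (int n + k)" "\<lambda>j. int j - int n"])
    fix j assume "j \<in> {0..2 * n}"
    hence "int n - (int j - int n) = int (2 * n - j)" "int n + (int j - int n) = int j"
          "1 - (int j - int n) = int n - int j + 1"
      by auto
    thus "of_int (Legendre (1 - (int j - int n)) 3) * h (int j - int n) =
          q ^ n\<^sup>2 * of_int (Legendre (int n - int j + 1) 3) / (qpoch q q (2 * n - j) * qpoch q q j)"
      by (simp only: h_def inv_qpoch_of_nat) (simp only: mult_ac times_divide_eq_right times_divide_eq_left divide_divide_eq_left mult_1)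
  qed auto
  also have "\<dots> = (\<Sum>r\<le>n. bilateral_coeff (\<lambda>k. of_int (Legendre (1 - k) 3)) r * h (int r))"
    by (rule sum_bilateral_fold) (simp add: h_def mult.commute)
  also have "\<dots> = (\<Sum>r\<le>n. q ^ n\<^sup>2 * bilateral_coeff ((powi) \<omega>) r / (qpoch q q (n - r) * qpoch q q (n + r)))"
  proof (rule sum.cong)
    fix r assume "r \<in> {..n}"
    hence "int n - int r = int (n - r)" "int n + int r = int (n + r)" by auto
    thus "bilateral_coeff (\<lambda>k. of_int (Legendre (1 - k) 3)) r * h (int r) =
            q ^ n\<^sup>2 * bilateral_coeff ((powi) \<omega>) r / (qpoch q q (n - r) * qpoch q q (n + r))"
      by (simp only: h_def bilateral_coeff_Legendre[OF \<omega>] inv_qpoch_of_nat)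
         (simp only: mult_ac times_divide_eq_right times_divide_eq_left divide_divide_eq_left mult_1)
  qed simp
  finally show ?thesis .
qed

text \<open>
  Factor by factor this is \<open>(1 + \<omega> x) (1 + x / \<omega>) (1 + x) = 1 + x^3\<close>.
\<close>

lemma qpoch_inf_cube:
  fixes A q \<omega> :: complex
  assumes q: "norm q < 1" and \<omega>: "\<omega>\<^sup>2 + \<omega> + 1 = 0"
  shows "qpoch_inf (- \<omega> * A) q * qpoch_inf (- A / \<omega>) q * qpoch_inf (- A) q = qpoch_inf (- (A ^ 3)) (q ^ 3)"
proof -
  have q3: "norm (q ^ 3) < 1" using q by (simp add: norm_power power_less_one_iff)
  have "\<omega> \<noteq> 0" using \<omega> by auto
  hence factor: "(1 + \<omega> * x) * (1 + x / \<omega>) * (1 + x) = 1 + x ^ 3" for x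
  proof -
    have "\<omega> * ((1 + \<omega> * x) * (1 + x / \<omega>) * (1 + x)) = (1 + \<omega> * x) * (\<omega> + x) * (1 + x)"
      using \<open>\<omega> \<noteq> 0\<close> by (simp add: field_simps)
    also have "\<dots> = \<omega> * (1 + x ^ 3) + (\<omega>\<^sup>2 + \<omega> + 1) * (x + x\<^sup>2)"
      by (simp add: algebra_simps power2_eq_square power3_eq_cube)
    also have "\<dots> = \<omega> * (1 + x ^ 3)" using \<omega> by simp
    finally show ?thesis using \<open>\<omega> \<noteq> 0\<close> by simp
  qed
  have "qpoch (- \<omega> * A) q n * qpoch (- A / \<omega>) q n * qpoch (- A) q n = qpoch (- (A ^ 3)) (q ^ 3) n" for n
  proof -
    have "1 - (- \<omega> * A) * q ^ i = 1 + \<omega> * (A * q ^ i)" "1 - (- A / \<omega>) * q ^ i = 1 + (A * q ^ i) / \<omega>"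
         "1 - (- A) * q ^ i = 1 + A * q ^ i" "1 - (- (A ^ 3)) * (q ^ 3) ^ i = 1 + (A * q ^ i) ^ 3" for i
    proof -
      have "(q ^ 3) ^ i = (q ^ i) ^ 3"
        by (simp only: power_mult[symmetric] mult.commute[of 3])
      thus "1 - (- (A ^ 3)) * (q ^ 3) ^ i = 1 + (A * q ^ i) ^ 3"
        by (simp add: power_mult_distrib)
    qed (simp_all add: mult.assoc)
    thus ?thesis
      unfolding qpoch_def prod.distrib[symmetric] by (simp only: factor)
  qed
  hence "(\<lambda>n. qpoch (- \<omega> * A) q n * qpoch (- A / \<omega>) q n * qpoch (- A) q n) \<longlonglongrightarrow> qpoch_inf (- (A ^ 3)) (q ^ 3)"
    using qpoch_tendsto_qpoch_inf[OF q3, of "- (A ^ 3)"] by simp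
  moreover have "(\<lambda>n. qpoch (- \<omega> * A) q n * qpoch (- A / \<omega>) q n * qpoch (- A) q n)
      \<longlonglongrightarrow> qpoch_inf (- \<omega> * A) q * qpoch_inf (- A / \<omega>) q * qpoch_inf (- A) q"
    by (intro tendsto_mult qpoch_tendsto_qpoch_inf q)
  ultimately show ?thesis using LIMSEQ_unique by blast
qed

text \<open>
  The factor \<open>(q\<^sup>2; q\<^sup>2)\<^sub>\<infinity>\<close> cancels against \<open>(q; q)\<^sub>\<infinity>\<close> and leaves \<open>(q; q\<^sup>2)\<^sub>\<infinity>\<close> below.
  Multiplying numerator and denominator by \<open>(-q; q\<^sup>2)\<^sub>\<infinity>\<close> turns the former into
  \<open>(-q^3; q^6)\<^sub>\<infinity>\<close> and the latter into \<open>(q\<^sup>2; q^4)\<^sub>\<infinity>\<close>. Rewriting the first of these as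
  \<open>(q^6; q^12)\<^sub>\<infinity> / (q^3; q^6)\<^sub>\<infinity>\<close> and dissecting to base \<open>q^12\<close>, the factor
  \<open>(q^6; q^12)\<^sub>\<infinity>\<close> cancels.
\<close>

lemma theta_quotient_eq:
  fixes q \<omega> :: complex
  assumes q: "norm q < 1" and \<omega>: "\<omega>\<^sup>2 + \<omega> + 1 = 0"
  shows "qpoch_inf (q\<^sup>2) (q\<^sup>2) * qpoch_inf (- \<omega> * q) (q\<^sup>2) * qpoch_inf (- q / \<omega>) (q\<^sup>2) / qpoch_inf q q
         = 1 / qpoch_inf_list [q^2, q^3, q^9, q^10] (q^12)"
proof -
  have qn: "norm (q ^ n) < 1" if "n > 0" for n
    using q that by (simp add: norm_power power_less_one_iff)
  define P a b c where "P = qpoch_inf (q\<^sup>2) (q\<^sup>2)"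
    and "a = qpoch_inf (- \<omega> * q) (q\<^sup>2) * qpoch_inf (- q / \<omega>) (q\<^sup>2)"
    and "b = qpoch_inf (- q) (q\<^sup>2)" and "c = qpoch_inf q (q\<^sup>2)"
  define e where "e = (\<lambda>i. qpoch_inf (q ^ i) (q ^ 12))"
  have nz: "P \<noteq> 0" "b \<noteq> 0" "c \<noteq> 0" "\<And>i. i > 0 \<Longrightarrow> e i \<noteq> 0"
    unfolding P_def b_def c_def e_def
    by (rule qpoch_inf_nonzero; (rule qn)?; simp add: q)+
  have 1: "qpoch_inf q q = c * P"
    using qpoch_inf_dissect2[OF q, of q] by (simp add: P_def c_def power2_eq_square)
  have 2: "a * b = qpoch_inf (- (q ^ 3)) (q ^ 6)"
    using qpoch_inf_cube[OF qn \<omega>, of 2 q] by (simp add: a_def b_def flip: power_mult)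
  have 3: "c * b = qpoch_inf (q\<^sup>2) (q ^ 4)"
    using qpoch_inf_minus_mult[OF qn, of 2 q] by (simp add: b_def c_def flip: power_mult)
  have 4: "qpoch_inf (q ^ 3) (q ^ 6) * qpoch_inf (- (q ^ 3)) (q ^ 6) = e 6"
    using qpoch_inf_minus_mult[OF qn, of 6 "q ^ 3"] by (simp add: e_def flip: power_mult)
  have 5: "qpoch_inf (q ^ 3) (q ^ 6) = e 3 * e 9"
    using qpoch_inf_dissect2[OF qn, of 6 "q ^ 3"] by (simp add: e_def flip: power_mult power_add)
  have 6: "qpoch_inf (q\<^sup>2) (q ^ 4) = e 2 * e 6 * e 10"
    using qpoch_inf_dissect3[OF qn, of 4 "q\<^sup>2"] by (simp add: e_def flip: power_mult power_add)
  have "P * a / (c * P) = (a * b) / (c * b)" using nz by simp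
  also have "\<dots> = 1 / (e 2 * e 3 * e 9 * e 10)"
    using 2 4 5 nz unfolding 3 6 by (simp add: divide_simps mult_ac)
  finally show ?thesis
    by (simp add: 1 P_def a_def e_def qpoch_inf_list_def mult.assoc)
qed

lemma legendre_term_sums_complex:
  fixes q :: complex
  assumes q: "norm q < 1"
  shows "legendre_term q sums (1 / qpoch_inf_list [q^2, q^3, q^9, q^10] (q^12))"
proof -
  obtain \<omega> :: complex where \<omega>: "norm \<omega> = 1" "\<omega>\<^sup>2 + \<omega> + 1 = 0"
    by (rule primitive_cube_root_of_unity)
  let ?S = "\<Sum>r. bilateral_coeff ((powi) \<omega>) r * q ^ r\<^sup>2"
  have theta: "?S / qpoch_inf q q = 1 / qpoch_inf_list [q^2, q^3, q^9, q^10] (q^12)"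
  proof (cases "q = 0")
    case False
    thus ?thesis
      using jacobi_triple_product[OF q False \<omega>(1)] theta_quotient_eq[OF q \<omega>(2)] by simp
  next
    \<comment> \<open>At \<open>q = 0\<close> the theta series and all the products equal \<open>1\<close>.\<close>
    case True
    have "(\<lambda>r. if r = 0 then 1 else 0) sums (1 :: complex)"
      using sums_single[of 0 "\<lambda>_. 1 :: complex"] by (simp add: eq_commute)
    moreover have "(\<lambda>r. bilateral_coeff ((powi) \<omega>) r * q ^ r\<^sup>2) = (\<lambda>r. if r = 0 then 1 else 0)"
      by (auto simp: True bilateral_coeff_def)
    ultimately have "?S = 1" by (simp add: sums_iff)
    thus ?thesis by (simp add: True qpoch_inf_list_def qpoch_inf_def)
  qed
  show ?thesis
    unfolding legendre_term_eq[OF \<omega>(2), abs_def] theta[symmetric]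
    by (rule bailey_lemma_limit[OF q norm_bilateral_coeff_le[OF \<omega>(1)]])
qed

section \<open>From analytic functions to formal power series\<close>

text \<open>
  The \<open>i\<close>-th factor differs from \<open>1\<close> by \<open>\<bar>q\<bar>^(a + b i) \<le> r^i\<close>, so a geometric series dominates.
\<close>

lemma uniform_limit_qpoch:
  assumes "r < 1" "b > 0"
  shows "uniform_limit (cball 0 r) (\<lambda>n q. qpoch (q ^ a) (q ^ b) n)
           (\<lambda>q::complex. qpoch_inf (q ^ a) (q ^ b)) sequentially"
proof -
  have "uniformly_convergent_on (cball 0 r) (\<lambda>N q::complex. \<Prod>i<N. 1 + (- (q ^ a * (q ^ b) ^ i)))"
  proof (rule uniformly_convergent_on_prod)
    have le: "norm (norm (- (q ^ a * (q ^ b) ^ i))) \<le> \<bar>r\<bar> ^ i" if "q \<in> cball 0 r" for q :: complex and i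
    proof -
      have q: "norm q \<le> \<bar>r\<bar>" using that by auto
      have "norm (- (q ^ a * (q ^ b) ^ i)) = norm q ^ (a + b * i)"
        by (simp add: norm_mult norm_power power_add power_mult)
      also have "\<dots> \<le> norm q ^ i"
        using that assms by (intro power_decreasing) (auto intro: trans_le_add2)
      also have "\<dots> \<le> \<bar>r\<bar> ^ i" using q by (intro power_mono) auto
      finally show ?thesis by simp
    qed
    show "uniformly_convergent_on (cball 0 r) (\<lambda>N q::complex. \<Sum>i<N. norm (- (q ^ a * (q ^ b) ^ i)))"
    proof (cases "r \<ge> 0")
      case True
      show ?thesis
        by (rule Weierstrass_m_test'[OF le]) (use True assms in \<open>auto intro: summable_geometric\<close>)
    qed (auto simp: uniformly_convergent_on_def)
  qed (auto intro!: continuous_intros)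
  hence "uniformly_convergent_on (cball 0 r) (\<lambda>n q::complex. qpoch (q ^ a) (q ^ b) n)"
    by (simp add: qpoch_def)
  then obtain l where l: "uniform_limit (cball 0 r) (\<lambda>n q::complex. qpoch (q ^ a) (q ^ b) n) l sequentially"
    by (auto simp: uniformly_convergent_on_def)
  have "l q = qpoch_inf (q ^ a) (q ^ b)" if q: "q \<in> cball 0 r" for q
  proof -
    have "norm (q ^ b) < 1"
      using q assms by (simp add: norm_power power_less_one_iff)
    hence "(\<lambda>n. qpoch (q ^ a) (q ^ b) n) \<longlonglongrightarrow> qpoch_inf (q ^ a) (q ^ b)"
      by (rule qpoch_tendsto_qpoch_inf)
    thus ?thesis using tendsto_uniform_limitI[OF l q] LIMSEQ_unique by blast
  qed
  thus ?thesis using l by (subst uniform_limit_cong') auto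
qed

lemma holomorphic_qpoch [holomorphic_intros]:
  assumes "f holomorphic_on S" "g holomorphic_on S"
  shows "(\<lambda>q. qpoch (f q) (g q) n) holomorphic_on S"
  unfolding qpoch_def by (intro holomorphic_intros assms)

lemma holomorphic_qpoch_inf:
  assumes "b > 0"
  shows "(\<lambda>q::complex. qpoch_inf (q ^ a) (q ^ b)) holomorphic_on ball 0 1"
proof (rule holomorphic_uniform_sequence[where f = "\<lambda>n q. qpoch (q ^ a) (q ^ b) n"])
  fix x :: complex
  assume x: "x \<in> ball 0 1"
  define d where "d = (1 - norm x) / 2"
  have "cball x d \<subseteq> cball 0 (norm x + d)"
    by (simp add: cball_subset_cball_iff dist_norm)
  moreover have d: "d > 0" "norm x + d < 1" using x by (auto simp: d_def field_simps)
  ultimately have "cball x d \<subseteq> ball 0 1"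
    "uniform_limit (cball x d) (\<lambda>n q. qpoch (q ^ a) (q ^ b) n) (\<lambda>q. qpoch_inf (q ^ a) (q ^ b)) sequentially"
    using uniform_limit_on_subset[OF uniform_limit_qpoch[OF d(2) assms]] by auto
  thus "\<exists>d>0. cball x d \<subseteq> ball 0 1 \<and> uniform_limit (cball x d) (\<lambda>n q. qpoch (q ^ a) (q ^ b) n)
           (\<lambda>q. qpoch_inf (q ^ a) (q ^ b)) sequentially"
    using d by blast
qed (auto intro!: holomorphic_intros)

text \<open>
  The bridge from analysis to formal power series. Uniform convergence near \<open>0\<close> makes each Taylor
  coefficient converge in \<open>\<complex>\<close>. If in addition each coefficient is eventually constant along the
  sequence, then its constant value is the limit, and that is convergence in the
  \<open>X\<close>-adic topology.
\<close>

lemma fps_tendsto_of_uniform_limit: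
  fixes f :: "nat \<Rightarrow> complex \<Rightarrow> complex"
  assumes lim: "uniform_limit A f g sequentially"
    and A: "open A" "0 \<in> A" "\<And>n. f n holomorphic_on A"
    and F: "\<And>n. f n has_fps_expansion F n" and G: "g has_fps_expansion G"
    and stable: "\<And>n k. k < n \<Longrightarrow> fps_nth (F (Suc n)) k = fps_nth (F n) k"
  shows "F \<longlonglongrightarrow> G"
proof (rule tendsto_fpsI)
  fix k
  have const: "fps_nth (F n) k = fps_nth (F (Suc k)) k" if "n \<ge> Suc k" for n
    using that by (induction n rule: dec_induct) (auto simp: stable)
  have "(\<lambda>n. (deriv ^^ k) (f n) 0 / fact k) \<longlonglongrightarrow> (deriv ^^ k) g 0 / fact k"
    by (intro tendsto_divide tendsto_const higher_deriv_complex_uniform_limit[OF lim]) (use A in auto)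
  hence "(\<lambda>n. fps_nth (F n) k) \<longlonglongrightarrow> fps_nth G k"
    by (simp add: fps_nth_fps_expansion[OF F] fps_nth_fps_expansion[OF G])
  moreover have ev: "\<forall>\<^sub>F n in sequentially. fps_nth (F n) k = fps_nth (F (Suc k)) k"
    by (rule eventually_mono[OF eventually_ge_at_top[of "Suc k"]]) (rule const)
  ultimately have "(\<lambda>n. fps_nth (F (Suc k)) k) \<longlonglongrightarrow> fps_nth G k"
    by (rule Lim_transform_eventually)
  hence "fps_nth (F (Suc k)) k = fps_nth G k" by (simp add: LIMSEQ_const_iff)
  thus "\<forall>\<^sub>F n in sequentially. fps_nth (F n) k = fps_nth G k" using ev by simp
qed

lemma has_fps_expansion_qpoch:
  fixes F G :: "complex fps"
  assumes "f has_fps_expansion F" "g has_fps_expansion G"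
  shows "(\<lambda>q. qpoch (f q) (g q) n) has_fps_expansion qpoch F G n"
  unfolding qpoch_def by (intro fps_expansion_intros assms)

text \<open>
  The two sides use infinite products in two different topologies. The coefficient of \<open>X^k\<close> in
  the partial products no longer changes once \<open>n > k\<close>, so the bridge lemma applies; the formal
  limit has constant coefficient \<open>1\<close>, as an infinite product is required to have a nonzero limit.
\<close>

lemma has_fps_expansion_qpoch_inf:
  assumes "a > 0" "b > 0"
  shows "(\<lambda>q::complex. qpoch_inf (q ^ a) (q ^ b)) has_fps_expansion qpoch_inf (fps_X ^ a) (fps_X ^ b)"
proof -
  define g where "g = (\<lambda>q::complex. qpoch_inf (q ^ a) (q ^ b))"
  define F where "F = (\<lambda>n. qpoch (fps_X ^ a) (fps_X ^ b) n :: complex fps)"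
  have holo: "g holomorphic_on ball 0 1"
    unfolding g_def by (rule holomorphic_qpoch_inf[OF assms(2)])
  have G: "g has_fps_expansion fps_expansion g 0"
    by (rule has_fps_expansion_fps_expansion[OF _ _ holo]) auto
  have "F \<longlonglongrightarrow> fps_expansion g 0"
  proof (rule fps_tendsto_of_uniform_limit[where A = "ball 0 (1/2)" and g = g])
    show "uniform_limit (ball 0 (1/2)) (\<lambda>n q. qpoch (q ^ a) (q ^ b) n) g sequentially"
      unfolding g_def by (rule uniform_limit_on_subset[OF uniform_limit_qpoch[of "1/2"]]) (use assms in auto)
    show "(\<lambda>q. qpoch (q ^ a) (q ^ b) n) has_fps_expansion F n" for n
      unfolding F_def by (intro has_fps_expansion_qpoch fps_expansion_intros)
    fix n k :: nat
    assume "k < n"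
    hence "k < a + b * n" using assms by (cases b) auto
    moreover have "F (Suc n) = F n - F n * fps_X ^ (a + b * n)"
      by (simp add: F_def qpoch_Suc algebra_simps power_add power_mult)
    ultimately show "fps_nth (F (Suc n)) k = fps_nth (F n) k"
      by (simp add: fps_X_power_mult_right_nth)
  qed (auto intro!: holomorphic_intros G)
  hence "(\<lambda>n. \<Prod>i<n. 1 - fps_X ^ a * (fps_X ^ b) ^ i) \<longlonglongrightarrow> fps_expansion g 0"
    by (simp only: F_def qpoch_def)
  hence "(\<lambda>n. \<Prod>i\<le>n. 1 - fps_X ^ a * (fps_X ^ b) ^ i) \<longlonglongrightarrow> fps_expansion g 0"
    by (simp only: LIMSEQ_lessThan_iff_atMost)
  moreover have "fps_expansion g 0 \<noteq> 0"
  proof -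
    have "fps_nth (fps_expansion g 0) 0 = g 0"
      using has_fps_expansion_imp_0_eq_fps_nth_0[OF G] by simp
    also have "\<dots> = 1" using assms by (simp add: g_def qpoch_inf_def power_0_left)
    finally show ?thesis by auto
  qed
  ultimately have "(\<lambda>i. 1 - fps_X ^ a * (fps_X ^ b) ^ i) has_prod fps_expansion g 0"
    by (auto simp: has_prod_def raw_has_prod_def)
  hence "qpoch_inf (fps_X ^ a) (fps_X ^ b) = fps_expansion g 0"
    unfolding qpoch_inf_def using has_prod_unique by metis
  thus ?thesis using G by (simp add: g_def)
qed

lemma holomorphic_product_side:
  "(\<lambda>q::complex. 1 / qpoch_inf_list [q^2, q^3, q^9, q^10] (q^12)) holomorphic_on ball 0 1"
proof -
  have "qpoch_inf (q ^ a) (q ^ 12) \<noteq> 0" if "norm q < 1" "a > 0" for q :: complex and a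
    by (rule qpoch_inf_nonzero) (use that in \<open>simp_all add: norm_power power_less_one_iff\<close>)
  thus ?thesis
    unfolding qpoch_inf_list_def by (auto intro!: holomorphic_intros holomorphic_qpoch_inf)
qed

lemma has_fps_expansion_product_side:
  "(\<lambda>q::complex. 1 / qpoch_inf_list [q^2, q^3, q^9, q^10] (q^12)) has_fps_expansion
     1 / qpoch_inf_list [fps_X^2, fps_X^3, fps_X^9, fps_X^10] (fps_X^12)"
proof -
  have "fps_nth (qpoch_inf (fps_X ^ a) (fps_X ^ 12) :: complex fps) 0 = 1" if "a > 0" for a :: nat
    using has_fps_expansion_imp_0_eq_fps_nth_0[OF has_fps_expansion_qpoch_inf[OF that, of 12]] that
    by (simp add: qpoch_inf_def power_0_left)
  thus ?thesis
    unfolding qpoch_inf_list_def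
    by (auto intro!: fps_expansion_intros has_fps_expansion_qpoch_inf)
qed

lemma fps_nth_qpoch_0: "fps_nth (qpoch fps_X fps_X n) 0 = (1 :: complex)"
  by (induction n) (simp_all add: qpoch_Suc)

lemma has_fps_expansion_legendre_term:
  "(\<lambda>q::complex. legendre_term q n) has_fps_expansion legendre_term fps_X n"
proof -
  have "(\<lambda>q::complex. q ^ n\<^sup>2 * of_int m / (qpoch q q i * qpoch q q j)) has_fps_expansion
          fps_X ^ n\<^sup>2 * fps_const (of_int m) / (qpoch fps_X fps_X i * qpoch fps_X fps_X j)"
    for m :: int and i j
    by (intro has_fps_expansion_divide' has_fps_expansion_mult has_fps_expansion_qpoch
          has_fps_expansion_fps_X_power has_fps_expansion_fps_X has_fps_expansion_const)
       (simp add: fps_nth_qpoch_0)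
  thus ?thesis
    unfolding legendre_term_def by (intro has_fps_expansion_sum) (simp add: fps_of_int)
qed

lemma fps_nth_legendre_term_eq_0:
  assumes "k < n"
  shows "fps_nth (legendre_term fps_X n :: complex fps) k = 0"
proof -
  have "n \<le> n\<^sup>2" by (simp add: power2_eq_square)
  hence "k < n\<^sup>2" using assms by simp
  thus ?thesis
    unfolding legendre_term_def fps_sum_nth
    by (intro sum.neutral ballI)
       (simp add: fps_divide_unit fps_nth_qpoch_0 mult.assoc fps_X_power_mult_nth)
qed

text \<open>
  The radius \<open>1/4\<close> is chosen so that the number \<open>2 n + 1 \<le> 2 * 2^n\<close> of summands in each term is
  absorbed by the factor \<open>\<bar>q\<bar>^(n\<^sup>2) \<le> 4^(-n)\<close>. Any neighbourhood of \<open>0\<close> suffices for comparing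
  Taylor coefficients.
\<close>

lemma uniform_limit_legendre_series:
  "uniform_limit (ball 0 (1/4)) (\<lambda>N q. \<Sum>n<N. legendre_term q n)
     (\<lambda>q::complex. 1 / qpoch_inf_list [q^2, q^3, q^9, q^10] (q^12)) sequentially"
proof -
  obtain C where C: "C > 0" "\<And>q :: complex. \<And>n. norm q \<le> 1/4 \<Longrightarrow> norm (1 / qpoch q q n) \<le> C"
    using inverse_qpoch_bounded[of "1/4"] by auto
  have "norm (legendre_term q n) \<le> 2 * (C * C) * (1/2) ^ n" if "q \<in> ball 0 (1/4)" for n and q :: complex
  proof -
    have q: "norm q \<le> 1/4" using that by simp
    have "norm (q ^ n\<^sup>2) \<le> norm q ^ n"
      unfolding norm_power using q by (intro power_decreasing) (auto simp: power2_eq_square)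
    also have "\<dots> \<le> (1/4) ^ n" using q by (intro power_mono) auto
    finally have qn: "norm (q ^ n\<^sup>2) \<le> (1/4) ^ n" .
    have "norm (q ^ n\<^sup>2 * of_int (Legendre m 3) / (qpoch q q i * qpoch q q j)) \<le> (1/4) ^ n * 1 * (C * C)"
      for m i j
    proof -
      have "norm (of_int (Legendre m 3) :: complex) \<le> 1" by (simp add: Legendre_def)
      hence "norm (q ^ n\<^sup>2) * norm (of_int (Legendre m 3) :: complex) *
              (norm (1 / qpoch q q i) * norm (1 / qpoch q q j)) \<le> (1/4) ^ n * 1 * (C * C)"
        using C q by (intro mult_mono mult_nonneg_nonneg qn) auto
      thus ?thesis by (simp add: norm_mult norm_divide)
    qed
    hence "norm (legendre_term q n) \<le> of_nat (card {0..2*n}) * ((1/4) ^ n * 1 * (C * C))"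
      unfolding legendre_term_def by (intro sum_norm_bound)
    also have "\<dots> = real (2 * n + 1) * ((1/2) ^ n * (1/2) ^ n * (C * C))"
      by (simp add: power_mult_distrib[symmetric])
    also have "\<dots> \<le> 2 * 2 ^ n * ((1/2) ^ n * (1/2) ^ n * (C * C))"
    proof (intro mult_right_mono)
      have "2 * n + 1 \<le> 2 * 2 ^ n" using less_exp[of n] by linarith
      thus "real (2 * n + 1) \<le> 2 * 2 ^ n"
        by (metis of_nat_le_iff of_nat_mult of_nat_numeral of_nat_power)
    qed (use C in auto)
    also have "\<dots> = 2 * (C * C) * (1/2) ^ n"
      by (simp add: power_divide)
    finally show ?thesis .
  qed
  hence "uniform_limit (ball 0 (1/4)) (\<lambda>N q. \<Sum>n<N. legendre_term q n)
           (\<lambda>q::complex. \<Sum>n. legendre_term q n) sequentially"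
    by (rule Weierstrass_m_test) (assumption, intro summable_mult summable_geometric, simp)
  also have "?this \<longleftrightarrow> ?thesis"
    by (intro uniform_limit_cong') (use legendre_term_sums_complex in \<open>auto simp: sums_iff\<close>)
  finally show ?thesis .
qed

lemma legendre_term_sums_fps:
  "legendre_term (fps_X :: complex fps) sums
     (1 / qpoch_inf_list [fps_X^2, fps_X^3, fps_X^9, fps_X^10] (fps_X^12))"
  unfolding sums_def
proof (rule fps_tendsto_of_uniform_limit[OF uniform_limit_legendre_series])
  show "(\<lambda>q::complex. \<Sum>n<N. legendre_term q n) holomorphic_on ball 0 (1/4)" for N
    unfolding legendre_term_def
    by (intro holomorphic_intros) (use qpoch_self_nonzero in auto)
  show "(\<lambda>q::complex. \<Sum>n<N. legendre_term q n) has_fps_expansion (\<Sum>n<N. legendre_term fps_X n)" for N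
    by (intro has_fps_expansion_sum has_fps_expansion_legendre_term)
qed (simp_all add: has_fps_expansion_product_side fps_nth_legendre_term_eq_0)

theorem theorem2p5:
  shows
    "(let q = (fps_X :: complex fps) in
        (\<lambda>n. \<Sum>j=0..2*n. q ^ (n^2) * of_int (Legendre (int n - int j + 1) 3)
                 / (qpoch q q (2*n - j) * qpoch q q j))
          sums (1 / qpoch_inf_list [q^2, q^3, q^9, q^10] (q^12)))
     \<and> (\<forall>q::complex. norm q < 1 \<longrightarrow>
        (\<lambda>n. \<Sum>j=0..2*n. q ^ (n^2) * of_int (Legendre (int n - int j + 1) 3)
                 / (qpoch q q (2*n - j) * qpoch q q j))
          sums (1 / qpoch_inf_list [q^2, q^3, q^9, q^10] (q^12)))
     \<and> (\<lambda>q::complex. 1 / qpoch_inf_list [q^2, q^3, q^9, q^10] (q^12)) analytic_on ball 0 1"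
  using legendre_term_sums_fps legendre_term_sums_complex holomorphic_product_side
  by (simp add: legendre_term_def[abs_def] analytic_on_open)

end
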